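(* Let $k\ge3$ and $n=2k$, let $\ell=\frac{k-3}2$ if $k$ is odd and $\ell=\frac k2$ if $k$ is even, let $\eta\in\mathbb{F}_q^*$ and $\mathbf{v}=(v_1,\dots,v_n)\in(\mathbb{F}_q^* )^n$. Consider the twisted generalized elliptic curve code $\mathcal{C}(D,kO,\ell,\eta,\mathbf{v})$ over an elliptic curve of the second type ($y^2+y=f(x)$, $q$ even), with the notation of the context. 1. If $k$ is odd, $\mathcal{C}(D,kO,\ell,\eta,\mathbf{v})$ is self-dual if and only if $\sum_{i=1}^{n}\gamma_i\alpha_i^{k+1}=0$ and there exists $\lambda\in\mathbb{F}_q^*$ such that $v_i^2=\lambda\gamma_i$ for $i=1,\dots,n$. 2. If $k$ is even, $\mathcal{C}(D,kO,\ell,\eta,\mathbf{v})$ is self-dual if and only if $\sum_{i=1}^{n}\gamma_i\alpha_i^{k-2}\beta_i^2=0$ and there exists $\mu\in\mathbb{F}_q^*$ such that $v_i^2=\mu\gamma_i$ for $i=1,\dots,n$.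
   Context: Second type: $q$ even, $F=\mathbb{F}_q(x,y)$ with $y^2+y=f(x)$, $f\in\mathbb{F}_q[x]$, $\deg f=3$; $O$ is the unique pole of $x$. Evaluation points: $T\subseteq\mathbb{F}_q$ is a set of $k$ elements $\alpha$ for which $Y^2+Y=f(\alpha)$ has (two) solutions in $\mathbb{F}_q$; $P_1,\dots,P_n$, $P_i=(\alpha_i,\beta_i)$, are all the $n=2k$ affine rational points with $x$-coordinate in $T$, and $D=P_1+\cdots+P_n$. Put $t=\prod_{\alpha\in T}(x-\alpha)$, $\omega=dx/t$, $\gamma_i=\mathrm{res}_{P_i}(\omega)$. Code: $\mathcal{C}(D,kO,\ell,\eta,\mathbf{v})=\{(v_1g(P_1),\dots,v_ng(P_n)): g\in S_\ell\}$, where for odd $k$ and $0\le\ell\le\frac{k-3}{2}$, $$S_\ell=\Big\{\sum_{i=0}^{(k-1)/2}a_ix^i+\sum_{j=0}^{(k-3)/2}b_jx^jy+b_\ell\eta x^{\frac{k+1}{2}}: a_i,b_j\in\mathbb{F}_q\Big\},$$ and for even $k$ and $0\le\ell\le\frac{k}{2}$, $$S_\ell=\Big\{\sum_{i=0}^{k/2}a_ix^i+\sum_{j=0}^{(k-4)/2}b_jx^jy+a_\ell\eta x^{\frac{k-2}{2}}y: a_i,b_j\in\mathbb{F}_q\Big\}.$$ Self-dual means equal to its Euclidean dual. *)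

theory Defs
  imports
    "HOL-Computational_Algebra.Computational_Algebra"
    "Jordan_Normal_Form.Matrix"
begin

section \<open>Function fields \<open>K(x, y)\<close> with \<open>y\<^sup>2 + y = f(x)\<close>\<close>

text \<open>
  The constant field \<open>K\<close> and the function field \<open>F\<close> are two types, and \<open>\<iota> : K \<rightarrow> F\<close> is the
  inclusion of the constants. The last clause says that \<open>F = K(x, y)\<close>, i.e. that the only
  subfield of \<open>F\<close> containing the constants, \<open>x\<close> and \<open>y\<close> is \<open>F\<close>.
\<close>

definition is_subfield :: "'F::field set \<Rightarrow> bool" where
  "is_subfield S \<longleftrightarrow>
     0 \<in> S \<and> 1 \<in> S \<and>
     (\<forall>a\<in>S. \<forall>b\<in>S. a + b \<in> S \<and> a * b \<in> S) \<and>
     (\<forall>a\<in>S. - a \<in> S \<and> inverse a \<in> S)"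

definition second_type_function_field ::
  "('K::field \<Rightarrow> 'F::field) \<Rightarrow> 'K poly \<Rightarrow> 'F \<Rightarrow> 'F \<Rightarrow> bool" where
  "second_type_function_field \<iota> f x y \<longleftrightarrow>
     field_hom \<iota> \<and>
     degree f = 3 \<and>
     (\<forall>p. p \<noteq> 0 \<longrightarrow> poly (map_poly \<iota> p) x \<noteq> 0) \<and>
     y\<^sup>2 + y = poly (map_poly \<iota> f) x \<and>
     (\<forall>S. is_subfield S \<and> range \<iota> \<subseteq> S \<and> x \<in> S \<and> y \<in> S \<longrightarrow> S = UNIV)"

text \<open>The rational points \<open>(\<alpha>, \<beta>)\<close> of the affine curve whose \<open>x\<close>-coordinate lies in \<open>T\<close>.\<close>

definition affine_points :: "'K::field poly \<Rightarrow> 'K set \<Rightarrow> ('K \<times> 'K) set" where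
  "affine_points f T = {(\<alpha>, \<beta>). \<alpha> \<in> T \<and> \<beta>\<^sup>2 + \<beta> = poly f \<alpha>}"


section \<open>Local expansions, values and residues\<close>

text \<open>
  In characteristic 2 the derivative of \<open>y\<^sup>2 + y - f(x)\<close> with respect to \<open>y\<close> is \<open>1\<close>, so \<open>x - \<alpha>\<close> is
  a local parameter at every affine rational point \<open>P = (\<alpha>, \<beta>)\<close>. The expansion at \<open>P\<close> is the
  embedding of \<open>F\<close> into its completion at \<open>P\<close>, the field of Laurent series over \<open>K\<close> in
  \<open>fls_X = x - \<alpha>\<close>. It is the unique field homomorphism that is the identity on constants and maps
  \<open>x\<close> to \<open>\<alpha> + fls_X\<close> and \<open>y\<close> to a power series with constant term \<open>\<beta>\<close>.
\<close>

definition expansion_at ::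
  "('K::field \<Rightarrow> 'F::field) \<Rightarrow> 'F \<Rightarrow> 'F \<Rightarrow> 'K \<times> 'K \<Rightarrow> 'F \<Rightarrow> 'K fls" where
  "expansion_at \<iota> x y P = (THE \<phi>.
     field_hom \<phi> \<and>
     (\<forall>c. \<phi> (\<iota> c) = fls_const c) \<and>
     \<phi> x = fls_const (fst P) + fls_X \<and>
     (\<exists>Y. \<phi> y = fps_to_fls Y \<and> fps_nth Y 0 = snd P))"

text \<open>The value \<open>g(P)\<close>; meaningful only if \<open>g\<close> has no pole at \<open>P\<close>.\<close>

definition value_at ::
  "('K::field \<Rightarrow> 'F::field) \<Rightarrow> 'F \<Rightarrow> 'F \<Rightarrow> 'F \<Rightarrow> 'K \<times> 'K \<Rightarrow> 'K" where
  "value_at \<iota> x y g P = fls_nth (expansion_at \<iota> x y P g) 0"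

text \<open>The residue at \<open>P\<close> of the differential \<open>g dh\<close>: with \<open>u = x - \<alpha>\<close> one has \<open>dh = (dh/du) du\<close>.\<close>

definition residue_at ::
  "('K::field \<Rightarrow> 'F::field) \<Rightarrow> 'F \<Rightarrow> 'F \<Rightarrow> 'F \<Rightarrow> 'F \<Rightarrow> 'K \<times> 'K \<Rightarrow> 'K" where
  "residue_at \<iota> x y g h P =
     fls_residue (expansion_at \<iota> x y P g * fls_deriv (expansion_at \<iota> x y P h))"


section \<open>Twisted generalized elliptic curve codes\<close>

text \<open>
  The parameters are meant to satisfy \<open>k \<ge> 3\<close>, and \<open>l \<le> (k - 3) / 2\<close> for odd \<open>k\<close>,
  \<open>l \<le> k / 2\<close> for even \<open>k\<close>; then none of the subtractions below is truncated.
\<close>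

definition twisted_space ::
  "('K::field \<Rightarrow> 'F::field) \<Rightarrow> 'F \<Rightarrow> 'F \<Rightarrow> nat \<Rightarrow> nat \<Rightarrow> 'K \<Rightarrow> 'F set" where
  "twisted_space \<iota> x y k l \<eta> =
     (if odd k
      then {(\<Sum>i=0..(k-1) div 2. \<iota> (a i) * x^i) + (\<Sum>j=0..(k-3) div 2. \<iota> (b j) * x^j * y)
              + \<iota> (b l) * \<iota> \<eta> * x^((k+1) div 2) | a b. True}
      else {(\<Sum>i=0..k div 2. \<iota> (a i) * x^i) + (\<Sum>j=0..(k-4) div 2. \<iota> (b j) * x^j * y)
              + \<iota> (a l) * \<iota> \<eta> * x^((k-2) div 2) * y | a b. True})"

text \<open>
  The code \<open>C(D, kO, l, \<eta>, v)\<close> of length \<open>n\<close>, where \<open>D\<close> is the sum of the points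
  \<open>P 0, \<dots>, P (n - 1)\<close>; coordinates are numbered from \<open>0\<close>.
\<close>

definition tgec_code ::
  "('K::field \<Rightarrow> 'F::field) \<Rightarrow> 'F \<Rightarrow> 'F \<Rightarrow> nat \<Rightarrow> (nat \<Rightarrow> 'K \<times> 'K) \<Rightarrow> nat \<Rightarrow> nat \<Rightarrow> 'K
     \<Rightarrow> (nat \<Rightarrow> 'K) \<Rightarrow> 'K vec set" where
  "tgec_code \<iota> x y n P k l \<eta> v =
     {vec n (\<lambda>i. v i * value_at \<iota> x y g (P i)) | g. g \<in> twisted_space \<iota> x y k l \<eta>}"

definition dual_code :: "nat \<Rightarrow> 'K::field vec set \<Rightarrow> 'K vec set" where
  "dual_code n C = {w \<in> carrier_vec n. \<forall>c\<in>C. w \<bullet> c = 0}"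

definition self_dual :: "nat \<Rightarrow> 'K::field vec set \<Rightarrow> bool" where
  "self_dual n C \<longleftrightarrow> C = dual_code n C"

end

theory Submission
  imports Defs "Jordan_Normal_Form.Char_Poly"
begin

text \<open>
  Write a function as \<open>A(x) + B(x) y\<close>. Over \<open>\<alpha> \<in> T\<close> the two points are \<open>(\<alpha>, \<beta>)\<close> and \<open>(\<alpha>, \<beta> + 1)\<close>,
  and \<open>\<gamma>\<close> takes the same value \<open>w(\<alpha>) = 1 / t'(\<alpha>)\<close> at both, so in characteristic 2
  \<open>\<Sum>\<^sub>i \<gamma>\<^sub>i (A + B y)(A' + B' y)(P\<^sub>i) = \<Sum>\<^sub>\<alpha> w(\<alpha>) (A B' + A' B + B B')(\<alpha>)\<close>, which by Lagrange interpolation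
  is the coefficient at \<open>x\<^bsup>k-1\<^esup>\<close> if the degree is below \<open>k\<close>. For both parities the twisted space is
  \<open>{A + B y | deg A \<le> r, deg B \<le> s, A\<^sub>r = \<theta> B\<^sub>s}\<close> with \<open>r + s = k - 1\<close>, and it is its own orthogonal space for
  this form. Conversely, if \<open>\<Sum>\<^sub>i v\<^sub>i\<^sup>2 (g h)(P\<^sub>i) = 0\<close> for all \<open>g, h\<close> in the space, the products \<open>g h\<close> span all
  functions \<open>A + B y\<close> with \<open>deg B \<le> k - 2\<close> on the points, a hyperplane, so \<open>v\<^sup>2\<close> is
  proportional to \<open>\<gamma>\<close>. The two sums in the theorem always vanish, because the two points of
  a fibre contribute equal terms in the first, and by \<open>\<beta>\<^sup>2 + (\<beta> + 1)\<^sup>2 = 1\<close> in the second.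
\<close>

section \<open>Expansions at rational points\<close>

text \<open>If 2 were nonzero, the pairs {u, -u} would split the nonzero elements into two-element
  sets, and the field would have odd size.\<close>

lemma even_card_imp_char_2:
  assumes "even (card (UNIV :: 'a::{field,finite} set))"
  shows "(2 :: 'a) = 0"
proof (rule ccontr)
  assume two: "(2 :: 'a) \<noteq> 0"
  define C where "C = (\<lambda>u::'a. {u, -u}) ` (UNIV - {0})"
  have neg: "u \<noteq> -u" if "u \<noteq> 0" for u :: 'a
    using that two by (metis add_eq_0_iff mult_2 mult_eq_0_iff)
  have "card {u, -u} = 2" if "u \<noteq> 0" for u :: 'a
    using neg[OF that] by (simp add: card_2_iff)
  then have "2 * card C = card (\<Union>C)"
    by (intro card_partition) (auto simp: C_def)
  moreover have "\<Union>C = UNIV - {0}"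
    by (auto simp: C_def)
  ultimately have "even (card (UNIV :: 'a set) - 1)"
    by (metis card_Diff_singleton dvd_triv_left UNIV_I)
  moreover have "card (UNIV :: 'a set) > 0"
    by (simp add: finite_UNIV_card_ge_0)
  ultimately show False
    using assms by simp
qed

text \<open>Together with \<open>generated\<close>, this reduces equality of two homomorphisms on F
  to equality on the constants, x and y.\<close>

lemma (in field_hom) is_subfield_equalizer:
  assumes "field_hom g"
  shows "is_subfield {z. hom z = g z}"
proof -
  interpret g: field_hom g by fact
  show ?thesis
    unfolding is_subfield_def by (auto simp: hom_distribs)
qed

text \<open>
  With \<open>Z\<close> the compositional inverse of \<open>X\<^sup>2 + X\<close> and \<open>c\<^sub>0\<close> the constant term of \<open>c\<close>,
  the root is \<open>b + Z(c - c\<^sub>0)\<close>, as \<open>Y\<^sup>2 + Y\<close> is additive.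
\<close>

lemma fps_artin_schreier_root:
  fixes c :: "'a::field fps"
  assumes "(2::'a) = 0" and "b\<^sup>2 + b = fps_nth c 0"
  obtains Y where "Y\<^sup>2 + Y = c" "fps_nth Y 0 = b"
proof -
  define a :: "'a fps" where "a = fps_X\<^sup>2 + fps_X"
  define d where "d = c - fps_const (fps_nth c 0)"
  define Z where "Z = fps_inv a"
  define W where "W = Z oo d"
  have d0: "fps_nth d 0 = 0" by (simp add: d_def)
  have a: "fps_nth a 0 = 0" "fps_nth a 1 \<noteq> 0" by (simp_all add: a_def)
  have Z0: "fps_nth Z 0 = 0"
    by (simp add: Z_def fps_inv_def)
  have "a oo Z = fps_X"
    unfolding Z_def by (rule fps_inv_right) (fact a)+
  then have "Z\<^sup>2 + Z = fps_X"
    by (simp add: a_def fps_compose_add_distrib Z0 flip: fps_compose_power[OF Z0])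
  then have "(Z\<^sup>2 + Z) oo d = d"
    using d0 by simp
  then have W: "W\<^sup>2 + W = d"
    by (simp add: W_def fps_compose_add_distrib flip: fps_compose_power[OF d0])
  have two: "(2::'a fps) = 0"
    using assms(1) by (metis fps_const_0_eq_0 fps_numeral_fps_const)
  have "(fps_const b + W)\<^sup>2 + (fps_const b + W) = fps_const (b\<^sup>2 + b) + (W\<^sup>2 + W)"
    by (simp add: power2_sum two flip: fps_const_add fps_const_power)
  also have "\<dots> = c"
    using assms(2) by (simp add: W d_def)
  finally show thesis
    using that[of "fps_const b + W"] Z0 by (simp add: W_def)
qed

section \<open>The field F as K(x) + K(x) y\<close>

locale second_type =
  fixes \<iota> :: "'K::field \<Rightarrow> 'F::field" and f :: "'K poly" and x y :: 'F
  assumes second_type: "second_type_function_field \<iota> f x y"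
begin

abbreviation E :: "'K poly \<Rightarrow> 'F" where
  "E p \<equiv> poly (map_poly \<iota> p) x"

lemma field_hom_const: "field_hom \<iota>"
  and degree_f: "degree f = 3"
  and transcendental: "p \<noteq> 0 \<Longrightarrow> E p \<noteq> 0"
  and curve: "y\<^sup>2 + y = E f"
  and generated: "is_subfield S \<Longrightarrow> range \<iota> \<subseteq> S \<Longrightarrow> x \<in> S \<Longrightarrow> y \<in> S \<Longrightarrow> S = UNIV"
  using second_type by (auto simp: second_type_function_field_def)

sublocale const: field_hom \<iota> by (rule field_hom_const)
sublocale const_poly: map_poly_inj_idom_hom \<iota> ..

lemma idom_hom_E: "idom_hom E"
  by unfold_locales (simp_all add: hom_distribs)

sublocale E: idom_hom E by (rule idom_hom_E)

lemma E_eq_0_iff [simp]: "E p = 0 \<longleftrightarrow> p = 0"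
  using transcendental[of p] by auto

lemma E_f: "E f = y * y + y"
  using curve by (simp add: power2_eq_square)

text \<open>If B were nonzero, substituting B y = -A into B^2 times the curve equation would give
  B^2 f = A (A - B), which the odd degree of f excludes.\<close>

lemma linear_independent:
  assumes "E A + E B * y = 0"
  shows "A = 0 \<and> B = 0"
proof -
  have "B = 0"
  proof (rule ccontr)
    assume B: "B \<noteq> 0"
    have eq: "E B * y = - E A"
      using assms by (simp add: eq_neg_iff_add_eq_0 add.commute)
    have "E (B * B * f) = (E B * y) * (E B * y) + E B * (E B * y)"
      by (simp add: E.hom_mult flip: curve) (simp add: power2_eq_square algebra_simps)
    also have "\<dots> = E (A * (A - B))"
      by (simp only: eq) (simp add: E.hom_mult E.hom_minus algebra_simps)
    finally have "E (B * B * f - A * (A - B)) = 0"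
      by (simp add: E.hom_minus)
    then have eq: "B * B * f = A * (A - B)" by (simp only: E_eq_0_iff) simp
    have f0: "f \<noteq> 0" using degree_f by auto
    with B eq have nz: "A \<noteq> 0" "A - B \<noteq> 0" by auto
    have "degree (B * B * f) = 2 * degree B + 3"
      using B f0 by (simp add: degree_mult_eq degree_f)
    moreover have "degree (A * (A - B)) = degree A + degree (A - B)"
      using nz by (rule degree_mult_eq)
    ultimately have deg: "2 * degree B + 3 = degree A + degree (A - B)"
      using eq by simp
    \<comment> \<open>The left side is odd; the right side is even if \<open>deg A > deg B\<close> and too small otherwise.\<close>
    show False
    proof (cases "degree B < degree A")
      case True
      then have "degree (A - B) = degree A"
        by (metis degree_add_eq_left degree_minus diff_conv_add_uminus)
      with deg have "2 * degree B + 3 = 2 * degree A" by simp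
      then show False by presburger
    next
      case False
      then have "degree (A - B) \<le> degree B"
        by (simp add: degree_diff_le)
      with deg False show False by linarith
    qed
  qed
  with assms show ?thesis by simp
qed

text \<open>These quotients form a subfield containing the constants, x and y, hence all of F.
  Products are reduced by y^2 = f - y, and inverses come from the conjugation y -> -1 - y.\<close>

lemma quotient_representation:
  "\<exists>A B C. C \<noteq> 0 \<and> g = (E A + E B * y) / E C"
proof -
  define S where "S = {g. \<exists>A B C. C \<noteq> 0 \<and> g = (E A + E B * y) / E C}"
  have SI: "C \<noteq> 0 \<Longrightarrow> g = (E A + E B * y) / E C \<Longrightarrow> g \<in> S" for g A B C
    unfolding S_def by blast
  have poly_S: "E A + E B * y \<in> S" for A B
    by (rule SI[of 1 _ A B]) simp_all
  have "is_subfield S"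
    unfolding is_subfield_def
  proof (intro conjI ballI)
    show "0 \<in> S" using poly_S[of 0 0] by simp
    show "1 \<in> S" using poly_S[of 1 0] by simp
  next
    fix g h assume "g \<in> S" "h \<in> S"
    then obtain A B C A' B' C' where
      nz: "C \<noteq> 0" "C' \<noteq> 0" and
      g: "g = (E A + E B * y) / E C" and h: "h = (E A' + E B' * y) / E C'"
      unfolding S_def by blast
    show "g + h \<in> S"
      by (rule SI[of "C * C'" _ "A * C' + A' * C" "B * C' + B' * C"])
         (use nz in \<open>simp_all add: g h hom_distribs field_simps\<close>)
    have "(E A + E B * y) * (E A' + E B' * y) =
        E (A * A' + B * B' * f) + E (A * B' + A' * B - B * B') * y"
      by (simp add: hom_distribs E_f algebra_simps)
    then show "g * h \<in> S"
      by (intro SI[of "C * C'" _ "A * A' + B * B' * f" "A * B' + A' * B - B * B'"])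
         (use nz in \<open>simp_all only: g h times_divide_times_eq E.hom_mult[of C], simp_all\<close>)
  next
    fix g assume "g \<in> S"
    then obtain A B C where nz: "C \<noteq> 0" and g: "g = (E A + E B * y) / E C"
      unfolding S_def by blast
    show "- g \<in> S"
      by (rule SI[of C _ "-A" "-B"])
         (use nz in \<open>simp_all add: g hom_distribs field_simps\<close>)
    show "inverse g \<in> S"
    proof (cases "g = 0")
      case True
      then show ?thesis using poly_S[of 0 0] by simp
    next
      case False
      \<comment> \<open>The norm of A + B y over K(x), i.e. its product with the conjugate (A - B) -
        B y.\<close>
      define N where "N = A * A - A * B - B * B * f"
      have nz1: "E A + E B * y \<noteq> 0" using False g by auto
      then have "A \<noteq> 0 \<or> B \<noteq> 0" by auto
      then have nz2: "E (A - B) + E (-B) * y \<noteq> 0"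
        using linear_independent[of "A - B" "-B"] by auto
      have N: "(E A + E B * y) * (E (A - B) + E (-B) * y) = E N"
        by (simp add: N_def hom_distribs E_f algebra_simps)
      then have "E N \<noteq> 0" using nz1 nz2 by (metis mult_eq_0_iff)
      moreover have "inverse g = E C * (E (A - B) + E (-B) * y) / E N"
        using nz1 nz2 by (simp add: g flip: N)
      ultimately show ?thesis
        by (intro SI[of N _ "C * (A - B)" "C * (-B)"])
           (simp_all only: E.hom_mult E_eq_0_iff, simp_all add: algebra_simps)
    qed
  qed
  moreover have "range \<iota> \<subseteq> S"
  proof
    fix z assume "z \<in> range \<iota>"
    then obtain c where "z = \<iota> c" by blast
    then show "z \<in> S" using poly_S[of "[:c:]" 0] by (simp add: hom_distribs)
  qed
  moreover have "x \<in> S" using poly_S[of "[:0, 1:]" 0] by simp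
  moreover have "y \<in> S" using poly_S[of 0 1] by simp
  ultimately have "S = UNIV" by (rule generated)
  then show ?thesis unfolding S_def by blast
qed

text \<open>The values are forced by \<open>quotient_representation\<close>;
  \<open>linear_independent\<close> makes them independent of the chosen quotient.\<close>

lemma extend_hom:
  fixes e :: "'K poly \<Rightarrow> 'L::field"
  assumes "idom_hom e" and inj: "\<And>p. e p = 0 \<Longrightarrow> p = 0" and Y: "Y\<^sup>2 + Y = e f"
  obtains \<phi> where "field_hom \<phi>" "\<And>p. \<phi> (E p) = e p" "\<phi> y = Y"
proof -
  interpret e: idom_hom e by fact
  have e0 [simp]: "e p = 0 \<longleftrightarrow> p = 0" for p using inj by auto
  have e_f: "e f = Y * Y + Y"
    using Y by (simp add: power2_eq_square)
  \<comment> \<open>The graph of the extension, kept as a relation until it is known to be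
    single-valued.\<close>
  define R where "R g r \<longleftrightarrow> (\<exists>A B C. C \<noteq> 0 \<and> g = (E A + E B * y) / E C \<and> r = (e A + e B * Y) / e C)" for g r
  have RI: "C \<noteq> 0 \<Longrightarrow> g = (E A + E B * y) / E C \<Longrightarrow> r = (e A + e B * Y) / e C \<Longrightarrow> R g r" for A B C g r
    unfolding R_def by blast
  have ex: "\<exists>r. R g r" for g
    using quotient_representation[of g] unfolding R_def by blast
  have unique: "r = s" if "R g r" "R g s" for g r s
  proof -
    from that obtain A B C A' B' C' where
      nz: "C \<noteq> 0" "C' \<noteq> 0" and
      g: "g = (E A + E B * y) / E C" "g = (E A' + E B' * y) / E C'" and
      rs: "r = (e A + e B * Y) / e C" "s = (e A' + e B' * Y) / e C'"
      unfolding R_def by blast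
    have "(E A + E B * y) / E C = (E A' + E B' * y) / E C'"
      using g by simp
    then have "(E A + E B * y) * E C' = (E A' + E B' * y) * E C"
      using nz by (simp add: field_simps)
    then have "E (A * C' - A' * C) + E (B * C' - B' * C) * y = 0"
      by (simp add: hom_distribs algebra_simps)
    from linear_independent[OF this] have "A * C' = A' * C" "B * C' = B' * C" by simp_all
    then have "e A * e C' = e A' * e C" "e B * e C' = e B' * e C"
      by (metis e.hom_mult)+
    then have "(e A + e B * Y) * e C' = (e A' + e B' * Y) * e C"
      by (simp add: algebra_simps) 
    then show ?thesis
      using nz by (simp add: rs field_simps)
  qed
  define \<phi> where "\<phi> g = (THE r. R g r)" for g
  have \<phi>: "\<phi> g = r" if "R g r" for g r
    unfolding \<phi>_def using that unique by blast
  have R: "R g (\<phi> g)" for g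
    using ex[of g] \<phi> by auto
  have poly: "\<phi> (E A + E B * y) = e A + e B * Y" for A B
    by (rule \<phi>, rule RI[of 1 _ A B]) simp_all
  have "field_hom \<phi>"
  proof
    show "\<phi> 0 = 0" using poly[of 0 0] by simp
    show "\<phi> 1 = 1" using poly[of 1 0] by simp
    fix g h
    obtain A B C A' B' C' where
      nz: "C \<noteq> 0" "C' \<noteq> 0" and
      g: "g = (E A + E B * y) / E C" "\<phi> g = (e A + e B * Y) / e C" and
      h: "h = (E A' + E B' * y) / E C'" "\<phi> h = (e A' + e B' * Y) / e C'"
      using R[of g] R[of h] unfolding R_def by blast
    show "\<phi> (g + h) = \<phi> g + \<phi> h"
      by (rule \<phi>, unfold g(2) h(2), rule RI[of "C * C'" _ "A * C' + A' * C" "B * C' + B' * C"])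
         (use nz in \<open>simp_all add: g(1) h(1) hom_distribs field_simps\<close>)
    have "(E A + E B * y) * (E A' + E B' * y) =
        E (A * A' + B * B' * f) + E (A * B' + A' * B - B * B') * y"
      by (simp add: hom_distribs E_f algebra_simps)
    moreover have "(e A + e B * Y) * (e A' + e B' * Y) =
        e (A * A' + B * B' * f) + e (A * B' + A' * B - B * B') * Y"
      by (simp add: hom_distribs e_f algebra_simps)
    ultimately show "\<phi> (g * h) = \<phi> g * \<phi> h"
      by (intro \<phi>, unfold g(2) h(2), intro RI[of "C * C'" _ "A * A' + B * B' * f" "A * B' + A' * B - B * B'"])
         (use nz in \<open>simp_all only: g(1) h(1) times_divide_times_eq E.hom_mult[of C] e.hom_mult[of C], simp_all\<close>)
  qed
  moreover have "\<phi> (E p) = e p" for p using poly[of p 0] by simp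
  moreover have "\<phi> y = Y" using poly[of 0 1] by simp
  ultimately show thesis by (rule that)
qed

text \<open>Makes the definite description in \<open>expansion_at\<close> usable. Existence comes
  from \<open>extend_hom\<close>, with the Taylor shift x -> a + X on polynomials and the
  Artin-Schreier root with constant term b as the image of y.\<close>

lemma expansion_at_hom:
  assumes two: "(2::'K) = 0" and P: "b\<^sup>2 + b = poly f a"
  defines "\<phi> \<equiv> expansion_at \<iota> x y (a, b)"
  shows "field_hom \<phi>"
    and "\<phi> (E p) = fps_to_fls (fps_of_poly (p \<circ>\<^sub>p [:a, 1:]))"
    and "\<exists>Y. \<phi> y = fps_to_fls Y \<and> fps_nth Y 0 = b"
proof -
  define e :: "'K poly \<Rightarrow> 'K fls" where "e p = fps_to_fls (fps_of_poly (p \<circ>\<^sub>p [:a, 1:]))" for p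
  have "idom_hom e"
    by unfold_locales (simp_all add: e_def pcompose_add pcompose_mult pcompose_1 fps_of_poly_add
        fps_of_poly_mult fls_times_fps_to_fls)
  moreover have "p = 0" if "e p = 0" for p
    using that pcompose_eq_0[of p "[:a, 1:]"] by (simp add: e_def fps_of_poly_eq_iff flip: fps_of_poly_0)
  moreover obtain Y where Y: "Y\<^sup>2 + Y = fps_of_poly (f \<circ>\<^sub>p [:a, 1:])" "fps_nth Y 0 = b"
    by (rule fps_artin_schreier_root[OF two, of b "fps_of_poly (f \<circ>\<^sub>p [:a, 1:])"]) (simp_all add: P)
  moreover have "(fps_to_fls Y)\<^sup>2 + fps_to_fls Y = e f"
    by (simp add: e_def flip: Y fps_to_fls_power)
  ultimately obtain \<psi> where \<psi>: "field_hom \<psi>" "\<And>p. \<psi> (E p) = e p" "\<psi> y = fps_to_fls Y"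
    using extend_hom[of e "fps_to_fls Y"] by blast
  interpret \<psi>: field_hom \<psi> by (rule \<psi>)
  have \<psi>c: "\<psi> (\<iota> c) = fls_const c" for c
    using \<psi>(2)[of "[:c:]"] by (simp add: e_def hom_distribs fps_of_poly_const)
  have \<psi>x: "\<psi> x = fls_const a + fls_X"
    using \<psi>(2)[of "[:0, 1:]"]
    by (simp add: e_def hom_distribs fps_of_poly_linear pcompose_pCons)
  have unique: "\<chi> = \<psi>" if \<chi>: "field_hom \<chi>" "\<And>c. \<chi> (\<iota> c) = fls_const c"
      "\<chi> x = fls_const a + fls_X" "\<chi> y = fps_to_fls Z" "fps_nth Z 0 = b" for \<chi> Z
  proof -
    interpret \<chi>: field_hom \<chi> by (rule \<chi>)
    have "\<chi> (E p) = \<psi> (E p)" for p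
      by (induction p) (simp_all add: hom_distribs \<chi>(2,3) \<psi>c \<psi>x)
    then have "\<chi> (y\<^sup>2 + y) = \<psi> (y\<^sup>2 + y)" by (simp add: curve)
    then have "fps_to_fls (Z\<^sup>2 + Z) = fps_to_fls (Y\<^sup>2 + Y)"
      by (simp add: hom_distribs \<chi>(4) \<psi>(3) fps_to_fls_power)
    then have "Z\<^sup>2 + Z = Y\<^sup>2 + Y" by (simp only: fps_to_fls_eq_iff)
    then have "(Z - Y) * (Z + Y + 1) = 0" by (simp add: algebra_simps power2_eq_square)
    \<comment> \<open>The constant term is 2 b + 1 = 1 in characteristic 2, so only the factor Z - Y
      can vanish.\<close>
    moreover have "fps_nth (Z + Y + 1) 0 \<noteq> 0"
      using two by (simp add: \<chi> Y flip: mult_2)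
    then have "Z + Y + 1 \<noteq> 0" by (metis fps_zero_nth)
    ultimately have "Z = Y" by simp
    moreover have "is_subfield {z. \<chi> z = \<psi> z}"
      by (rule \<chi>.is_subfield_equalizer) fact
    ultimately have "{z. \<chi> z = \<psi> z} = UNIV"
      by (intro generated) (auto simp: \<chi> \<psi> \<psi>c \<psi>x)
    then show ?thesis by auto
  qed
  have "\<phi> = \<psi>"
    unfolding \<phi>_def expansion_at_def
  proof (rule the_equality)
    show "field_hom \<psi> \<and> (\<forall>c. \<psi> (\<iota> c) = fls_const c) \<and> \<psi> x = fls_const (fst (a, b)) + fls_X \<and>
       (\<exists>Y. \<psi> y = fps_to_fls Y \<and> fps_nth Y 0 = snd (a, b))"
      using \<psi> \<psi>c \<psi>x Y(2) by auto
  qed (use unique in auto)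
  then show "field_hom \<phi>" "\<phi> (E p) = fps_to_fls (fps_of_poly (p \<circ>\<^sub>p [:a, 1:]))"
      "\<exists>Y. \<phi> y = fps_to_fls Y \<and> fps_nth Y 0 = b"
    using \<psi> Y(2) by (auto simp: e_def)
qed

lemma value_at_affine:
  assumes "(2::'K) = 0" "b\<^sup>2 + b = poly f a"
  shows "value_at \<iota> x y (E A + E B * y) (a, b) = poly A a + poly B a * b"
proof -
  interpret \<phi>: field_hom "expansion_at \<iota> x y (a, b)"
    by (rule expansion_at_hom[OF assms])
  obtain Y where Y: "expansion_at \<iota> x y (a, b) y = fps_to_fls Y" "fps_nth Y 0 = b"
    using expansion_at_hom(3)[OF assms] by blast
  show ?thesis
    by (simp add: value_at_def \<phi>.hom_add \<phi>.hom_mult expansion_at_hom(2)[OF assms] Y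
        flip: fls_times_fps_to_fls fps_to_fls_plus)
qed

text \<open>With x = a + X the denominator becomes X G, where G(0) is nonzero. So the pole is simple
  and, as dx = dX, the residue is 1 / G(0), whatever b is.\<close>

lemma residue_at_simple_pole:
  assumes "(2::'K) = 0" "b\<^sup>2 + b = poly f a" "finite T" "a \<in> T"
  shows "residue_at \<iota> x y (1 / (\<Prod>c\<in>T. x - \<iota> c)) x (a, b) = inverse (\<Prod>c\<in>T - {a}. a - c)"
proof -
  interpret \<phi>: field_hom "expansion_at \<iota> x y (a, b)"
    by (rule expansion_at_hom[OF assms(1,2)])
  define G where "G = (\<Prod>c\<in>T - {a}. [:a - c, 1:])"
  have G0: "fps_nth (fps_of_poly G) 0 = (\<Prod>c\<in>T - {a}. a - c)"
    by (simp add: G_def poly_prod flip: poly_0_coeff_0)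
  then have "fps_nth (fps_of_poly G) 0 \<noteq> 0"
    using assms(3) by (simp del: fps_of_poly_nth)
  then have sub: "subdegree (fps_of_poly G) = 0"
    by (rule subdegree_eq_0)
  have x: "x = E [:0, 1:]" by (simp add: hom_distribs)
  have t: "(\<Prod>c\<in>T. x - \<iota> c) = E (\<Prod>c\<in>T. [:-c, 1:])"
    by (simp add: E.hom_prod) (simp add: hom_distribs)
  have "(\<Prod>c\<in>T. [:-c, 1:]) \<circ>\<^sub>p [:a, 1:] = (\<Prod>c\<in>T. [:a - c, 1:])"
    by (simp add: pcompose_prod pcompose_pCons)
  also have "\<dots> = [:0, 1:] * G"
    using assms(3,4) by (simp add: G_def prod.remove)
  finally have "expansion_at \<iota> x y (a, b) (\<Prod>c\<in>T. x - \<iota> c) = fls_X * fps_to_fls (fps_of_poly G)"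
    unfolding t expansion_at_hom(2)[OF assms(1,2)]
    by (simp add: fps_of_poly_mult fls_times_fps_to_fls del: mult_pCons_left)
  then have "expansion_at \<iota> x y (a, b) (1 / (\<Prod>c\<in>T. x - \<iota> c))
      = fls_X_inv * fps_to_fls (inverse (fps_of_poly G))"
    by (simp add: \<phi>.hom_inverse divide_inverse fls_inverse_X fls_inverse_fps_to_fls[OF sub])
  moreover have "expansion_at \<iota> x y (a, b) x = fls_const a + fls_X"
    by (subst x, subst expansion_at_hom(2)[OF assms(1,2)])
      (simp add: pcompose_pCons fps_of_poly_linear)
  ultimately show ?thesis
    using G0 by (simp add: residue_at_def fls_X_inv_times_conv_shift)
qed

end

section \<open>Lagrange weights\<close>

lemma coeff_mult_top:
  fixes p q :: "'a::comm_semiring_1 poly"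
  assumes "degree p \<le> m" "degree q \<le> n"
  shows "coeff (p * q) (m + n) = coeff p m * coeff q n"
proof -
  have "coeff p i * coeff q (m + n - i) = (if i = m then coeff p m * coeff q n else 0)"
    if "i \<le> m + n" for i
  proof (cases "i < m")
    case True
    then have "degree q < m + n - i" using assms by simp
    then show ?thesis using True by (simp add: coeff_eq_0)
  next
    case False
    then show ?thesis using assms by (auto simp: coeff_eq_0)
  qed
  then have "coeff (p * q) (m + n) = (\<Sum>i\<le>m + n. if i = m then coeff p m * coeff q n else 0)"
    by (simp add: coeff_mult)
  then show ?thesis by simp
qed

definition node_poly :: "'a::field set \<Rightarrow> 'a \<Rightarrow> 'a poly" where
  "node_poly T a = (\<Prod>c\<in>T - {a}. [:- c, 1:])"

text \<open>For a in T this is 1 / t'(a), by \<open>residue_at_simple_pole\<close> the residue of dx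
  / t at the points over a.\<close>

definition node_weight :: "'a::field set \<Rightarrow> 'a \<Rightarrow> 'a" where
  "node_weight T a = inverse (\<Prod>c\<in>T - {a}. a - c)"

lemma
  assumes "finite T" "a \<in> T"
  shows degree_node_poly: "degree (node_poly T a) = card T - 1"
    and coeff_node_poly: "coeff (node_poly T a) (card T - 1) = 1"
    and node_weight_nonzero: "node_weight T a \<noteq> 0"
    and poly_node_poly: "c \<in> T \<Longrightarrow>
      poly (node_poly T a) c = (if c = a then inverse (node_weight T a) else 0)"
proof -
  have "degree (node_poly T a) = (\<Sum>c\<in>T - {a}. degree [:- c, 1:])"
    unfolding node_poly_def by (rule degree_prod_eq_sum_degree) auto
  then show deg: "degree (node_poly T a) = card T - 1"
    using assms by simp
  have "lead_coeff (node_poly T a) = 1"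
    unfolding node_poly_def by (simp add: lead_coeff_prod)
  then show "coeff (node_poly T a) (card T - 1) = 1"
    by (simp add: deg)
  show "node_weight T a \<noteq> 0"
    using assms by (simp add: node_weight_def)
  show "poly (node_poly T a) c = (if c = a then inverse (node_weight T a) else 0)" if "c \<in> T"
  proof (cases "c = a")
    case True
    then show ?thesis by (simp add: node_poly_def node_weight_def poly_prod)
  next
    case False
    then have "\<exists>d\<in>T - {a}. poly [:- d, 1:] c = 0" using that by auto
    then show ?thesis using False assms(1) by (simp add: node_poly_def poly_prod)
  qed
qed

definition interpolant :: "'a::field set \<Rightarrow> ('a \<Rightarrow> 'a) \<Rightarrow> 'a poly" where
  "interpolant T h = (\<Sum>a\<in>T. Polynomial.smult (node_weight T a * h a) (node_poly T a))"

text \<open>The node polynomials are monic of degree \<open>card T - 1\<close>, so the top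
  coefficient of the interpolant adds up the weighted values.\<close>

lemma
  assumes "finite T" "T \<noteq> {}"
  shows degree_interpolant: "degree (interpolant T h) < card T"
    and poly_interpolant: "c \<in> T \<Longrightarrow> poly (interpolant T h) c = h c"
    and coeff_interpolant: "coeff (interpolant T h) (card T - 1) = (\<Sum>a\<in>T. node_weight T a * h a)"
proof -
  have "degree (interpolant T h) \<le> card T - 1"
    unfolding interpolant_def
    by (rule degree_sum_le) (use assms in \<open>auto intro: order.trans[OF degree_smult_le] simp: degree_node_poly\<close>)
  moreover have "card T > 0"
    using assms by (simp add: card_gt_0_iff)
  ultimately show "degree (interpolant T h) < card T"
    by linarith
  show "poly (interpolant T h) c = h c" if c: "c \<in> T"
  proof -
    have "poly (interpolant T h) c = (\<Sum>a\<in>T. if a = c then h c else 0)"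
      unfolding interpolant_def poly_sum
      by (rule sum.cong) (use assms c in \<open>auto simp: poly_node_poly node_weight_nonzero\<close>)
    then show ?thesis using assms c by simp
  qed
  show "coeff (interpolant T h) (card T - 1) = (\<Sum>a\<in>T. node_weight T a * h a)"
    using assms by (simp add: interpolant_def coeff_sum coeff_node_poly del: One_nat_def)
qed

text \<open>A polynomial of degree below \<open>card T\<close> is its own interpolant, so
  \<open>coeff_interpolant\<close> applies to it. This is the residue theorem for p dx / t on the
  projective line.\<close>

lemma sum_node_weight_poly:
  assumes "finite T" "T \<noteq> {}" "degree p < card T"
  shows "(\<Sum>a\<in>T. node_weight T a * poly p a) = coeff p (card T - 1)"
proof -
  have "interpolant T (poly p) = p"
    by (rule poly_eqI_degree[of T]) (use assms in \<open>simp_all add: poly_interpolant degree_interpolant\<close>)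
  then show ?thesis
    using coeff_interpolant[OF assms(1,2), of "poly p"] by simp
qed

text \<open>If deg B were larger, x^i with i = \<open>card T - 1 - degree B\<close> would be among
  the test powers, and the weighted sum of x^i B would be the leading coefficient of B.\<close>

lemma degree_le_of_orthogonal:
  assumes T: "finite T" and B: "degree B < card T" and r: "r < card T"
    and orth: "\<And>i. i < r \<Longrightarrow> (\<Sum>a\<in>T. node_weight T a * (a ^ i * poly B a)) = 0"
  shows "degree B \<le> card T - 1 - r"
proof (rule ccontr)
  assume large: "\<not> degree B \<le> card T - 1 - r"
  define i where "i = card T - 1 - degree B"
  have i: "i < r" "i + degree B = card T - 1"
    using large B r by (auto simp: i_def)
  have "degree (monom 1 i * B) \<le> i + degree B"
    by (auto intro!: order.trans[OF degree_mult_le] add_mono degree_monom_le)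
  then have "(\<Sum>a\<in>T. node_weight T a * poly (monom 1 i * B) a) = coeff (monom 1 i * B) (card T - 1)"
    using B T i by (intro sum_node_weight_poly) auto
  also have "\<dots> = lead_coeff B"
    using coeff_mult_top[of "monom 1 i" i B "degree B"] by (simp add: i degree_monom_le)
  finally have "lead_coeff B = 0"
    using orth[OF i(1)] by (simp add: poly_monom)
  with large show False by simp
qed

lemma linear_functional_zero:
  fixes L :: "'a::comm_ring_1 poly \<Rightarrow> 'a"
  assumes add: "\<And>p q. L (p + q) = L p + L q" and smult: "\<And>c p. L (Polynomial.smult c p) = c * L p"
    and monom: "\<And>m. m \<le> d \<Longrightarrow> L (monom 1 m) = 0" and "degree p \<le> d"
  shows "L p = 0"
proof -
  have L0: "L 0 = 0" using smult[of 0 0] by simp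
  have sum: "L (sum g A) = (\<Sum>i\<in>A. L (g i))" if "finite A" for g :: "nat \<Rightarrow> _" and A
    using that by (induction A) (simp_all add: L0 add)
  have "L p = L (\<Sum>i\<le>d. monom (coeff p i) i)"
    using poly_as_sum_of_monoms'[OF assms(4)] by simp
  also have "\<dots> = (\<Sum>i\<le>d. L (Polynomial.smult (coeff p i) (monom 1 i)))"
    by (simp add: sum smult_monom)
  also have "\<dots> = 0"
    by (simp add: smult monom del: smult_monom)
  finally show ?thesis .
qed

section \<open>Orthogonality on the twisted spaces\<close>

text \<open>
  The twisted space for odd \<open>k\<close> is given by \<open>r = (k + 1) / 2\<close>, \<open>s = (k - 3) / 2\<close>, \<open>\<theta> = \<eta>\<close>, and for even \<open>k\<close>
  by \<open>r = k / 2\<close>, \<open>s = k / 2 - 1\<close>, \<open>\<theta> = 1 / \<eta>\<close>.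
\<close>

definition twisted_pairs :: "nat \<Rightarrow> nat \<Rightarrow> 'a::field \<Rightarrow> ('a poly \<times> 'a poly) set" where
  "twisted_pairs r s \<theta> = {(A, B). degree A \<le> r \<and> degree B \<le> s \<and> coeff A r = \<theta> * coeff B s}"

lemma monom_pair_twisted:
  assumes "i < r"
  shows "(monom 1 i, 0) \<in> twisted_pairs r s \<theta>"
  using assms by (auto simp: twisted_pairs_def intro: order.trans[OF degree_monom_le])

lemma monom_y_pair_twisted:
  assumes "j < s"
  shows "(0, monom 1 j) \<in> twisted_pairs r s \<theta>"
  using assms by (auto simp: twisted_pairs_def intro: order.trans[OF degree_monom_le])

lemma top_pair_twisted: "(monom \<theta> r, monom 1 s) \<in> twisted_pairs r s \<theta>"
  by (simp add: twisted_pairs_def degree_monom_le)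

section \<open>The weighted bilinear form on the fibres over T\<close>

locale evaluation_points =
  fixes f :: "'K::field poly" and T :: "'K set" and b :: "'K \<Rightarrow> 'K"
  assumes two: "(2::'K) = 0" and finite_T: "finite T" and T_nonempty: "T \<noteq> {}"
    and root: "a \<in> T \<Longrightarrow> (b a)\<^sup>2 + b a = poly f a"
begin

lemma add_self [simp]: "u + u = (0::'K)"
  using two by (metis mult_2 mult_zero_left)

lemma add_self_left [simp]: "u + (u + v) = (v::'K)"
  by (simp flip: add.assoc)

lemma add_eq_0_iff_eq: "u + v = 0 \<longleftrightarrow> u = (v::'K)"
  by (metis add_self add_left_cancel)

lemma uminus_eq [simp]: "- u = (u::'K)"
  by (metis add_self add_eq_0_iff)

text \<open>In characteristic 2 the difference of the values of Y^2 + Y at v and \<open>b a\<close>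
  factors as (v + b a) (v + b a + 1).\<close>

lemma affine_points_eq: "affine_points f T = (\<lambda>a. (a, b a)) ` T \<union> (\<lambda>a. (a, b a + 1)) ` T"
proof -
  have "v = b a \<or> v = b a + 1" if "v\<^sup>2 + v = poly f a" "a \<in> T" for a v
  proof -
    have "v\<^sup>2 + v + ((b a)\<^sup>2 + b a) = 0" using root[OF that(2)] that(1) by simp
    then have "(v + b a) * (v + (b a + 1)) = 0"
      by (simp add: algebra_simps power2_eq_square)
    then show ?thesis by (simp add: add_eq_0_iff_eq)
  qed
  moreover have "(b a + 1)\<^sup>2 + (b a + 1) = poly f a" if "a \<in> T" for a
    using root[OF that] by (simp add: power2_eq_square algebra_simps)
  ultimately show ?thesis
    using root by (auto simp: affine_points_def)
qed

lemma sum_affine_points: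
  "(\<Sum>p\<in>affine_points f T. G p) = (\<Sum>a\<in>T. G (a, b a) + G (a, b a + 1))"
proof -
  have "(\<Sum>p\<in>affine_points f T. G p) =
      sum G ((\<lambda>a. (a, b a)) ` T) + sum G ((\<lambda>a. (a, b a + 1)) ` T)"
    unfolding affine_points_eq by (rule sum.union_disjoint) (auto simp: finite_T)
  also have "\<dots> = (\<Sum>a\<in>T. G (a, b a)) + (\<Sum>a\<in>T. G (a, b a + 1))"
    by (simp add: sum.reindex inj_on_def)
  finally show ?thesis by (simp add: sum.distrib)
qed

text \<open>The pair (A, B) stands for A + B y, so the orthogonality arguments involve only
  polynomials over K.\<close>

definition pvalue :: "'K poly \<times> 'K poly \<Rightarrow> 'K \<times> 'K \<Rightarrow> 'K" where
  "pvalue g p = poly (fst g) (fst p) + poly (snd g) (fst p) * snd p"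

text \<open>Over a fibre A A' occurs twice and cancels, while A B' + A' B gets the factor b + (b +
  1) = 1 and B B' the factor b^2 + (b + 1)^2 = 1.\<close>

lemma sum_weighted_product:
  "(\<Sum>p\<in>affine_points f T. node_weight T (fst p) * (pvalue (A, B) p * pvalue (A', B') p)) =
   (\<Sum>a\<in>T. node_weight T a * poly (A * B' + A' * B + B * B') a)"
  unfolding sum_affine_points
proof (rule sum.cong)
  fix a
  have "pvalue (A, B) (a, b a) * pvalue (A', B') (a, b a) +
      pvalue (A, B) (a, b a + 1) * pvalue (A', B') (a, b a + 1) = poly (A * B' + A' * B + B * B') a"
    by (simp add: pvalue_def algebra_simps)
  then show "node_weight T (fst (a, b a)) * (pvalue (A, B) (a, b a) * pvalue (A', B') (a, b a)) +
      node_weight T (fst (a, b a + 1)) * (pvalue (A, B) (a, b a + 1) * pvalue (A', B') (a, b a + 1)) =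
      node_weight T a * poly (A * B' + A' * B + B * B') a"
    by (simp flip: distrib_left)
qed simp

text \<open>Only the coefficient at x^(r+s) counts. As deg (B B') <= 2 s < r + s, it is A_r B'_s +
  A'_r B_s = 2 \<theta> B_s B'_s = 0.\<close>

lemma twisted_pairs_orthogonal:
  assumes "card T = r + s + 1" "s < r"
    and "g \<in> twisted_pairs r s \<theta>" "h \<in> twisted_pairs r s \<theta>"
  shows "(\<Sum>p\<in>affine_points f T. node_weight T (fst p) * (pvalue g p * pvalue h p)) = 0"
proof -
  obtain A B A' B' where gh: "g = (A, B)" "h = (A', B')" by (cases g, cases h)
  with assms have A: "degree A \<le> r" "degree A' \<le> r" "degree B \<le> s" "degree B' \<le> s"
    and c: "coeff A r = \<theta> * coeff B s" "coeff A' r = \<theta> * coeff B' s"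
    by (auto simp: twisted_pairs_def)
  have "degree (A * B') \<le> r + s" "degree (A' * B) \<le> r + s" "degree (B * B') \<le> s + s"
    using A by (auto intro!: order.trans[OF degree_mult_le] add_mono)
  then have "degree (A * B' + A' * B + B * B') \<le> r + s"
    using assms(2) by (intro degree_add_le) auto
  moreover have "coeff (B * B') (r + s) = 0"
    using \<open>degree (B * B') \<le> s + s\<close> assms(2) by (intro coeff_eq_0) auto
  ultimately show ?thesis
    unfolding gh sum_weighted_product
    using assms(1) A
    by (subst sum_node_weight_poly[OF finite_T T_nonempty]) (simp_all add: coeff_mult_top c algebra_simps)
qed

text \<open>The ordinates over a differ by 1, so the two prescribed values differ by B(a); one of
  them then determines A(a). Both polynomials follow by interpolation.\<close>

lemma pvalue_surj:
  obtains A B where "degree A < card T" "degree B < card T"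
    "\<And>p. p \<in> affine_points f T \<Longrightarrow> pvalue (A, B) p = z p"
proof -
  define B where "B = interpolant T (\<lambda>a. z (a, b a) + z (a, b a + 1))"
  define A where "A = interpolant T (\<lambda>a. z (a, b a) + b a * (z (a, b a) + z (a, b a + 1)))"
  show thesis
  proof (rule that)
    show "degree A < card T" "degree B < card T"
      by (simp_all add: A_def B_def degree_interpolant finite_T T_nonempty)
    show "pvalue (A, B) p = z p" if "p \<in> affine_points f T" for p
      using that
      by (auto simp: affine_points_eq A_def B_def pvalue_def poly_interpolant finite_T T_nonempty
          algebra_simps)
  qed
qed

text \<open>Testing against x^i for i < r bounds deg B by s, testing against x^j y for j < s bounds
  deg A by r, and testing against \<theta> x^r + x^s y yields the twist condition.\<close>

lemma mem_twisted_pairs_of_orthogonal: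
  assumes k: "card T = r + s + 1" and "s < r"
    and deg: "degree A < card T" "degree B < card T"
    and orth: "\<And>h. h \<in> twisted_pairs r s \<theta> \<Longrightarrow>
      (\<Sum>p\<in>affine_points f T. node_weight T (fst p) * (pvalue (A, B) p * pvalue h p)) = 0"
  shows "(A, B) \<in> twisted_pairs r s \<theta>"
proof -
  note weighted = sum_node_weight_poly[OF finite_T T_nonempty]
  have orth': "(\<Sum>a\<in>T. node_weight T a * poly (A * B' + A' * B + B * B') a) = 0"
    if "(A', B') \<in> twisted_pairs r s \<theta>" for A' B'
    using orth[OF that] unfolding sum_weighted_product .
  have B: "degree B \<le> s"
    using degree_le_of_orthogonal[OF finite_T deg(2), of r] orth'[OF monom_pair_twisted] k
    by (simp add: poly_monom)
  have "(\<Sum>a\<in>T. node_weight T a * (a ^ j * poly A a)) = 0" if j: "j < s" for j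
  proof -
    \<comment> \<open>This is the B B' term of the form; its degree stays below r + s, so only the
      term with A survives.\<close>
    have "degree (B * monom 1 j) \<le> s + j"
      using B by (auto intro!: order.trans[OF degree_mult_le] add_mono degree_monom_le)
    then have "(\<Sum>a\<in>T. node_weight T a * poly (B * monom 1 j) a) = coeff (B * monom 1 j) (r + s)"
      using k j \<open>s < r\<close> by (subst weighted) auto
    also have "\<dots> = 0"
      using \<open>degree (B * monom 1 j) \<le> s + j\<close> j \<open>s < r\<close> by (intro coeff_eq_0) auto
    finally show ?thesis
      using orth'[OF monom_y_pair_twisted[OF j]]
      by (simp add: poly_monom sum.distrib algebra_simps)
  qed
  then have A: "degree A \<le> r"
    using degree_le_of_orthogonal[OF finite_T deg(1), of s] k by simp
  define Q where "Q = A * monom 1 s + monom \<theta> r * B + B * monom 1 s"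
  have d: "degree (A * monom 1 s) \<le> r + s" "degree (monom \<theta> r * B) \<le> r + s"
      "degree (B * monom 1 s) \<le> s + s"
    using A B by (auto intro!: order.trans[OF degree_mult_le] add_mono degree_monom_le)
  then have "degree Q \<le> r + s"
    unfolding Q_def using \<open>s < r\<close> by (intro degree_add_le) auto
  then have "coeff Q (r + s) = 0"
    using weighted[of Q] orth'[OF top_pair_twisted] k by (simp add: Q_def)
  moreover have "coeff (B * monom 1 s) (r + s) = 0"
    using d(3) \<open>s < r\<close> by (intro coeff_eq_0) auto
  ultimately have "coeff A r + \<theta> * coeff B s = 0"
    using A B by (simp add: Q_def coeff_mult_top degree_monom_le)
  then have "coeff A r = \<theta> * coeff B s"
    by (simp add: add_eq_0_iff_eq)
  with A B show ?thesis by (simp add: twisted_pairs_def)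
qed

text \<open>Products are split into x-part and y-part, measured by \<open>M\<close> and
  \<open>N\<close>. Vanishing of \<open>M\<close> up to degree r + s makes u constant on fibres,
  which kills \<open>M\<close> altogether; then \<open>N\<close> vanishes below degree r + s, and
  node polynomials recover u from \<open>N\<close>.\<close>

lemma orthogonal_weights_proportional:
  fixes u :: "'K \<times> 'K \<Rightarrow> 'K"
  assumes k: "card T = r + s + 1" "card T \<ge> 3" and rs: "r = s + 1 \<or> r = s + 2"
    and f: "degree f = 3"
    and orth: "\<And>g h. g \<in> twisted_pairs r s \<theta> \<Longrightarrow> h \<in> twisted_pairs r s \<theta> \<Longrightarrow>
      (\<Sum>p\<in>affine_points f T. u p * (pvalue g p * pvalue h p)) = 0"
  shows "\<exists>c. \<forall>p\<in>affine_points f T. u p = c * node_weight T (fst p)"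
proof -
  define M where "M q = (\<Sum>p\<in>affine_points f T. u p * poly q (fst p))" for q
  define N where "N q = (\<Sum>p\<in>affine_points f T. u p * (poly q (fst p) * snd p))" for q
  have M_add: "M (p + q) = M p + M q" and N_add: "N (p + q) = N p + N q" for p q
    by (simp_all add: M_def N_def sum.distrib algebra_simps)
  have M_smult: "M (Polynomial.smult c p) = c * M p"
    and N_smult: "N (Polynomial.smult c p) = c * N p" for c p
    by (simp_all add: M_def N_def sum_distrib_left mult_ac)
  have sq: "snd p * snd p = poly f (fst p) + snd p" if "p \<in> affine_points f T" for p
  proof -
    have "poly f (fst p) = snd p * snd p + snd p"
      using that by (auto simp: affine_points_def power2_eq_square)
    then show ?thesis by (simp add: add.assoc)
  qed
  \<comment> \<open>With y^2 = f + y the product has x-part A A' + B B' f and y-part A B' + A' B + B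
    B'.\<close>
  have product: "M (A * A') + N (A * B' + A' * B) + (M (B * B' * f) + N (B * B')) = 0"
    if "(A, B) \<in> twisted_pairs r s \<theta>" "(A', B') \<in> twisted_pairs r s \<theta>" for A B A' B'
  proof -
    have "u p * (pvalue (A, B) p * pvalue (A', B') p) =
        u p * poly (A * A') (fst p) + u p * (poly (A * B' + A' * B) (fst p) * snd p) +
        (u p * poly (B * B' * f) (fst p) + u p * (poly (B * B') (fst p) * snd p))"
      if "p \<in> affine_points f T" for p
    proof -
      have "pvalue (A, B) p * pvalue (A', B') p = poly (A * A') (fst p) +
          poly (A * B' + A' * B) (fst p) * snd p + poly (B * B') (fst p) * (snd p * snd p)"
        by (simp add: pvalue_def algebra_simps)
      then show ?thesis by (simp only: sq[OF that]) (simp add: algebra_simps)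
    qed
    then have "(\<Sum>p\<in>affine_points f T. u p * (pvalue (A, B) p * pvalue (A', B') p)) =
        M (A * A') + N (A * B' + A' * B) + (M (B * B' * f) + N (B * B'))"
      by (simp add: M_def N_def sum.distrib)
    then show ?thesis using orth[OF that] by simp
  qed
  have M0 [simp]: "M 0 = 0" and N0 [simp]: "N 0 = 0" by (simp_all add: M_def N_def)

  have M_low: "M (monom 1 m) = 0" if m: "m \<le> 2 * r - 2" for m
  proof -
    \<comment> \<open>The first exponent is taken as large as possible; the rest is below r because
      m <= 2 r - 2.\<close>
    obtain i j where "m = i + j" "i < r" "j < r"
    proof
      show "m = min m (r - 1) + (m - min m (r - 1))" by simp
      show "min m (r - 1) < r" "m - min m (r - 1) < r" using m rs by arith+
    qed
    then show ?thesis
      using product[OF monom_pair_twisted monom_pair_twisted, of i j] by (simp add: mult_monom)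
  qed
  have N_low: "N (monom 1 m) = 0" if m: "m + 2 \<le> r + s" "s > 0" for m
  proof -
    obtain i j where "m = i + j" "i < r" "j < s"
    proof
      show "m = min m (r - 1) + (m - min m (r - 1))" by simp
      show "min m (r - 1) < r" "m - min m (r - 1) < s" using m rs by arith+
    qed
    then show ?thesis
      using product[OF monom_pair_twisted monom_y_pair_twisted, of i j] by (simp add: mult_monom)
  qed
  have M_monom: "M (monom 1 m) = 0" if "m \<le> r + s" for m
  proof (cases "m \<le> 2 * r - 2")
    case True
    then show ?thesis by (rule M_low)
  next
    case False
    with that rs have m: "m = 2 * s + 1" and r: "r = s + 1" by auto
    with k have s: "s > 0" by simp
    \<comment> \<open>For \<open>r = s + 1\<close> products of powers of \<open>x\<close> miss \<open>x\<^bsup>k-1\<^esup>\<close>; it is the leading term of the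
      \<open>x\<close>-part of \<open>(x\<^bsup>s-1\<^esup> y)\<^sup>2 = x\<^bsup>2s-2\<^esup> (f + y)\<close>.\<close>
    define q where "q = monom (1::'K) (2 * s - 2) * f"
    have "M q + N (monom 1 (2 * s - 2)) = 0"
      using product[OF monom_y_pair_twisted monom_y_pair_twisted, of "s - 1" "s - 1"] s
      by (simp add: mult_monom q_def flip: mult_2) (simp add: diff_mult_distrib2)
    then have "M q = 0" using N_low[of "2 * s - 2"] r s by simp
    have dq: "degree q \<le> m"
      unfolding q_def by (rule order.trans[OF degree_mult_le])
        (use degree_monom_le[of "1::'K" "2 * s - 2"] m s in \<open>simp add: f\<close>)
    have cq: "coeff q m = coeff f 3"
      using m s by (simp add: q_def coeff_monom_mult)
    \<comment> \<open>Removing the top monomial leaves degree at most 2 s = 2 r - 2, where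
      \<open>M_low\<close> applies; what remains of M q = 0 is f_3 M(x^m) = 0.\<close>
    define q' where "q' = q - monom (coeff q m) m"
    have "degree q' \<le> 2 * s"
    proof (rule degree_le, intro allI impI)
      fix i assume "2 * s < i"
      then show "coeff q' i = 0"
        using dq m by (cases "i = m") (auto simp: q'_def intro: coeff_eq_0)
    qed
    then have "M q' = 0"
      by (rule linear_functional_zero[of M "2 * s", OF M_add M_smult M_low, rotated]) (use r in simp)
    moreover have "q = q' + Polynomial.smult (coeff q m) (monom 1 m)"
      by (simp add: q'_def smult_monom)
    then have "M q = M q' + coeff q m * M (monom 1 m)"
      by (metis M_add M_smult)
    ultimately have "coeff f 3 * M (monom 1 m) = 0"
      using \<open>M q = 0\<close> cq by simp
    moreover have "coeff f 3 \<noteq> 0"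
      using f leading_coeff_0_iff[of f] by auto
    ultimately show ?thesis by simp
  qed
  have node: "degree (node_poly T a) = r + s" if "a \<in> T" for a
    using degree_node_poly[OF finite_T that] k by simp
  have u_eq: "u (a, b a + 1) = u (a, b a)" if a: "a \<in> T" for a
  proof -
    \<comment> \<open>The node polynomial has degree r + s and vanishes on T outside a, so
      \<open>M\<close> sees only the fibre over a.\<close>
    have "M (node_poly T a) = (\<Sum>c\<in>T. if c = a
        then (u (a, b a) + u (a, b a + 1)) * inverse (node_weight T a) else 0)"
      unfolding M_def sum_affine_points
      by (rule sum.cong) (use a in \<open>auto simp: poly_node_poly finite_T algebra_simps\<close>)
    also have "\<dots> = (u (a, b a) + u (a, b a + 1)) * inverse (node_weight T a)"
      using a finite_T by simp
    finally have "(u (a, b a) + u (a, b a + 1)) * inverse (node_weight T a) = 0"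
      using linear_functional_zero[of M "r + s" "node_poly T a", OF M_add M_smult M_monom] node[OF a]
      by simp
    then have "u (a, b a) + u (a, b a + 1) = 0"
      using node_weight_nonzero[OF finite_T a] by simp
    then show ?thesis by (simp add: add_eq_0_iff_eq)
  qed
  have M_zero: "M q = 0" for q
    unfolding M_def sum_affine_points by (simp add: u_eq)
  have N_eq: "N q = (\<Sum>a\<in>T. u (a, b a) * poly q a)" for q
    unfolding N_def sum_affine_points by (rule sum.cong) (simp_all add: u_eq flip: distrib_left)
  have N_monom: "N (monom 1 m) = 0" if "m \<le> r + s - 1" for m
  proof (cases "m < s")
    case True
    then show ?thesis by (intro N_low) (use rs in auto)
  next
    case False
    \<comment> \<open>Exponents s + i with i < r come from x^i times the top pair, whose x-part
      contributes nothing since \<open>M\<close> is zero.\<close>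
    then obtain i where i: "m = s + i" by (metis le_Suc_ex not_less)
    with that rs have "i < r" by auto
    then show ?thesis
      using product[OF monom_pair_twisted top_pair_twisted, of i]
      by (simp add: M_zero mult_monom i add.commute)
  qed
  have "u (a, b a) = N (monom 1 (r + s)) * node_weight T a" if a: "a \<in> T" for a
  proof -
    \<comment> \<open>The node polynomial is monic, so q has lower degree and \<open>N\<close> takes
      the same value N(x^(r+s)) on every node polynomial: the common factor sought.\<close>
    define q where "q = node_poly T a - monom 1 (r + s)"
    have c: "coeff (node_poly T a) (r + s) = 1"
      using coeff_node_poly[OF finite_T a] k by simp
    have "degree q \<le> r + s - 1"
    proof (rule degree_le, intro allI impI)
      fix i assume "r + s - 1 < i"
      then show "coeff q i = 0"
        using node[OF a] c by (cases "i = r + s") (auto simp: q_def intro: coeff_eq_0)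
    qed
    then have "N q = 0"
      by (intro linear_functional_zero[of N "r + s - 1" q, OF N_add N_smult] N_monom)
    then have "N (node_poly T a) = N (monom 1 (r + s))"
      using N_add[of q "monom 1 (r + s)"] by (simp add: q_def)
    moreover have "N (node_poly T a) = (\<Sum>c\<in>T. if c = a then u (a, b a) * inverse (node_weight T a) else 0)"
      unfolding N_eq by (rule sum.cong) (use a in \<open>auto simp: poly_node_poly finite_T\<close>)
    then have "N (node_poly T a) = u (a, b a) * inverse (node_weight T a)"
      using a finite_T by simp
    ultimately show ?thesis
      using node_weight_nonzero[OF finite_T a] by (simp add: field_simps)
  qed
  then show ?thesis
    by (intro exI[of _ "N (monom 1 (r + s))"]) (auto simp: affine_points_eq u_eq)
qed

section \<open>Self-duality of codes from twisted pairs\<close>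

definition twisted_code :: "nat \<Rightarrow> (nat \<Rightarrow> 'K \<times> 'K) \<Rightarrow> nat \<Rightarrow> nat \<Rightarrow> 'K \<Rightarrow> (nat \<Rightarrow> 'K) \<Rightarrow> 'K vec set" where
  "twisted_code n P r s \<theta> v = (\<lambda>g. vec n (\<lambda>i. v i * pvalue g (P i))) ` twisted_pairs r s \<theta>"

text \<open>Two code words pair to the sum of v_i^2 (g h)(P_i). Self-orthogonality thus makes v^2
  proportional to the weights; conversely the pairing is c times the weighted form, under which the
  twisted pairs are their own orthogonal space.\<close>

lemma self_dual_twisted_code_iff:
  assumes k: "card T = r + s + 1" "card T \<ge> 3" and rs: "r = s + 1 \<or> r = s + 2"
    and f: "degree f = 3" and P: "bij_betw P {0..<n} (affine_points f T)"
    and v: "\<And>i. i < n \<Longrightarrow> v i \<noteq> 0"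
  shows "self_dual n (twisted_code n P r s \<theta> v) \<longleftrightarrow>
    (\<exists>c. c \<noteq> 0 \<and> (\<forall>i<n. (v i)\<^sup>2 = c * node_weight T (fst (P i))))"
proof
  have reindex: "(\<Sum>i\<in>{0..<n}. G (P i)) = (\<Sum>p\<in>affine_points f T. G p)" for G :: "_ \<Rightarrow> 'K"
    using P by (rule sum.reindex_bij_betw)
  have mem: "P i \<in> affine_points f T" if "i < n" for i
    using P that by (auto dest: bij_betwE)
  have inner: "vec n (\<lambda>i. v i * pvalue g (P i)) \<bullet> vec n (\<lambda>i. v i * pvalue h (P i)) =
      (\<Sum>i\<in>{0..<n}. (v i)\<^sup>2 * (pvalue g (P i) * pvalue h (P i)))" for g h
    by (simp add: scalar_prod_def power2_eq_square mult_ac)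
  {
    assume self: "self_dual n (twisted_code n P r s \<theta> v)"
    \<comment> \<open>The squares are carried from indices to points along the bijection
      \<open>P\<close>.\<close>
    define u where "u p = (v (inv_into {0..<n} P p))\<^sup>2" for p
    have u: "u (P i) = (v i)\<^sup>2" if "i < n" for i
      using P that by (simp add: u_def bij_betw_inv_into_left)
    have "(\<Sum>p\<in>affine_points f T. u p * (pvalue g p * pvalue h p)) = 0"
      if "g \<in> twisted_pairs r s \<theta>" "h \<in> twisted_pairs r s \<theta>" for g h
    proof -
      have "vec n (\<lambda>i. v i * pvalue g (P i)) \<in> dual_code n (twisted_code n P r s \<theta> v)"
        using self that(1) unfolding self_dual_def twisted_code_def by blast
      then have "vec n (\<lambda>i. v i * pvalue g (P i)) \<bullet> vec n (\<lambda>i. v i * pvalue h (P i)) = 0"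
        using that(2) unfolding dual_code_def twisted_code_def by blast
      then show ?thesis
        unfolding inner reindex[symmetric] by (simp add: u)
    qed
    from orthogonal_weights_proportional[OF k rs f this]
    obtain c where c: "\<And>p. p \<in> affine_points f T \<Longrightarrow> u p = c * node_weight T (fst p)" by blast
    have eq: "\<forall>i<n. (v i)\<^sup>2 = c * node_weight T (fst (P i))"
      using c[OF mem] u by simp
    moreover have "c \<noteq> 0"
    proof -
      have "affine_points f T \<noteq> {}" using T_nonempty by (auto simp: affine_points_eq)
      then have "n > 0" using P by (auto simp: bij_betw_def)
      then show ?thesis using eq v by force
    qed
    ultimately show "\<exists>c. c \<noteq> 0 \<and> (\<forall>i<n. (v i)\<^sup>2 = c * node_weight T (fst (P i)))" by blast
  }
  {
    assume "\<exists>c. c \<noteq> 0 \<and> (\<forall>i<n. (v i)\<^sup>2 = c * node_weight T (fst (P i)))"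
    then obtain c where c: "c \<noteq> 0" "\<And>i. i < n \<Longrightarrow> (v i)\<^sup>2 = c * node_weight T (fst (P i))" by blast
    have "s < r" using rs by auto
    have inner': "vec n (\<lambda>i. v i * pvalue g (P i)) \<bullet> vec n (\<lambda>i. v i * pvalue h (P i)) =
        c * (\<Sum>p\<in>affine_points f T. node_weight T (fst p) * (pvalue g p * pvalue h p))" for g h
      unfolding inner reindex[symmetric] by (simp add: c(2) sum_distrib_left mult_ac)
    show "self_dual n (twisted_code n P r s \<theta> v)"
      unfolding self_dual_def
    proof (intro equalityI subsetI)
      fix w assume "w \<in> twisted_code n P r s \<theta> v"
      then show "w \<in> dual_code n (twisted_code n P r s \<theta> v)"
        unfolding dual_code_def twisted_code_def
        using twisted_pairs_orthogonal[OF k(1) \<open>s < r\<close>] by (auto simp: inner')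
    next
      fix w assume w: "w \<in> dual_code n (twisted_code n P r s \<theta> v)"
      then have dim: "dim_vec w = n" by (auto simp: dual_code_def)
      \<comment> \<open>Every vector of length n is the word of some pair with degrees below
        \<open>card T\<close>, found by interpolating w_i / v_i at P_i.\<close>
      obtain A B where AB: "degree A < card T" "degree B < card T"
        "\<And>p. p \<in> affine_points f T \<Longrightarrow>
          pvalue (A, B) p = w $ inv_into {0..<n} P p / v (inv_into {0..<n} P p)"
        using pvalue_surj[of "\<lambda>p. w $ inv_into {0..<n} P p / v (inv_into {0..<n} P p)"] by metis
      have w_eq: "w = vec n (\<lambda>i. v i * pvalue (A, B) (P i))"
      proof (rule eq_vecI)
        fix i assume "i < dim_vec (vec n (\<lambda>i. v i * pvalue (A, B) (P i)))"
        then have "i < n" by simp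
        then show "w $ i = vec n (\<lambda>i. v i * pvalue (A, B) (P i)) $ i"
          using P v by (simp add: AB(3)[OF mem] bij_betw_inv_into_left)
      qed (simp add: dim)
      have "(\<Sum>p\<in>affine_points f T. node_weight T (fst p) * (pvalue (A, B) p * pvalue h p)) = 0"
        if "h \<in> twisted_pairs r s \<theta>" for h
      proof -
        have "w \<bullet> vec n (\<lambda>i. v i * pvalue h (P i)) = 0"
          using w that unfolding dual_code_def twisted_code_def by blast
        then show ?thesis using c(1) unfolding w_eq inner' by simp
      qed
      then have "(A, B) \<in> twisted_pairs r s \<theta>"
        by (rule mem_twisted_pairs_of_orthogonal[OF k(1) \<open>s < r\<close> AB(1,2)])
      then show "w \<in> twisted_code n P r s \<theta> v"
        unfolding twisted_code_def w_eq by blast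
    qed
  }
qed

end

section \<open>The self-duality criterion\<close>

lemma obtain_poly_with_coeffs:
  obtains p :: "'a::comm_monoid_add poly" where "degree p \<le> d" "\<And>i. i \<le> d \<Longrightarrow> coeff p i = c i"
proof
  show "degree (\<Sum>i\<le>d. monom (c i) i) \<le> d"
    by (intro degree_sum_le) (auto intro: order.trans[OF degree_monom_le])
  show "coeff (\<Sum>i\<le>d. monom (c i) i) i = c i" if "i \<le> d" for i
    using that by (simp add: coeff_sum)
qed

section \<open>Twisted spaces as spaces of coefficient pairs\<close>

context second_type
begin

lemma E_eq_sum:
  assumes "degree p \<le> d"
  shows "E p = (\<Sum>i=0..d. \<iota> (coeff p i) * x ^ i)"
  by (subst poly_as_sum_of_monoms'[OF assms, symmetric])
     (simp add: hom_distribs poly_sum poly_monom atMost_atLeast0)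

text \<open>With l = (k - 3) / 2 = m the twist is attached to the top coefficient of B, and \<eta>
  b_m becomes the coefficient of A at x^(m+2).\<close>

lemma twisted_space_odd:
  "twisted_space \<iota> x y (2 * m + 3) m \<eta> = (\<lambda>(A, B). E A + E B * y) ` twisted_pairs (m + 2) m \<eta>"
    (is "?L = ?R")
proof -
  have L: "?L = {(\<Sum>i=0..m + 1. \<iota> (a i) * x ^ i) + (\<Sum>j=0..m. \<iota> (b j) * x ^ j * y)
      + \<iota> (b m) * \<iota> \<eta> * x ^ (m + 2) | a b. True}"
    by (simp add: twisted_space_def)
  have E: "E A + E B * y = (\<Sum>i=0..m + 1. \<iota> (coeff A i) * x ^ i) +
      (\<Sum>j=0..m. \<iota> (coeff B j) * x ^ j * y) + \<iota> (coeff B m) * \<iota> \<eta> * x ^ (m + 2)"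
    if "(A, B) \<in> twisted_pairs (m + 2) m \<eta>" for A B
  proof -
    have "degree A \<le> Suc (m + 1)" "degree B \<le> m" "coeff A (Suc (m + 1)) = \<eta> * coeff B m"
      using that by (auto simp: twisted_pairs_def)
    then show ?thesis
      by (simp add: E_eq_sum[of A "Suc (m + 1)"] E_eq_sum[of B m] sum_distrib_right hom_distribs)
  qed
  show ?thesis
  proof (intro equalityI subsetI)
    fix g assume "g \<in> ?L"
    then obtain a b where g: "g = (\<Sum>i=0..m + 1. \<iota> (a i) * x ^ i) +
        (\<Sum>j=0..m. \<iota> (b j) * x ^ j * y) + \<iota> (b m) * \<iota> \<eta> * x ^ (m + 2)"
      unfolding L by blast
    obtain A where A: "degree A \<le> m + 2"
        "\<And>i. i \<le> m + 2 \<Longrightarrow> coeff A i = (if i = m + 2 then \<eta> * b m else a i)"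
      using obtain_poly_with_coeffs[of "m + 2" "\<lambda>i. if i = m + 2 then \<eta> * b m else a i"] by blast
    obtain B where B: "degree B \<le> m" "\<And>j. j \<le> m \<Longrightarrow> coeff B j = b j"
      using obtain_poly_with_coeffs[of m b] by blast
    have AB: "(A, B) \<in> twisted_pairs (m + 2) m \<eta>"
      using A B by (simp add: twisted_pairs_def)
    have "g = E A + E B * y"
      unfolding E[OF AB] g by (auto simp: A B intro!: arg_cong2[of _ _ _ _ "(+)"] sum.cong)
    with AB show "g \<in> ?R" by force
  next
    fix g assume "g \<in> ?R"
    then obtain A B where AB: "(A, B) \<in> twisted_pairs (m + 2) m \<eta>" and g: "g = E A + E B * y"
      by auto
    show "g \<in> ?L"
      unfolding L mem_Collect_eq g E[OF AB] by (intro exI[of _ "coeff A"] exI[of _ "coeff B"]) simp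
  qed
qed

text \<open>With l = k / 2 = m + 2 the twist is attached to the top coefficient of A and reads
  B_(m+1) = \<eta> A_(m+2); solving for A_(m+2) gives the factor 1 / \<eta>.\<close>

lemma twisted_space_even:
  assumes "\<eta> \<noteq> 0"
  shows "twisted_space \<iota> x y (2 * m + 4) (m + 2) \<eta> =
    (\<lambda>(A, B). E A + E B * y) ` twisted_pairs (m + 2) (m + 1) (inverse \<eta>)" (is "?L = ?R")
proof -
  have L: "?L = {(\<Sum>i=0..m + 2. \<iota> (a i) * x ^ i) + (\<Sum>j=0..m. \<iota> (b j) * x ^ j * y)
      + \<iota> (a (m + 2)) * \<iota> \<eta> * x ^ (m + 1) * y | a b. True}"
    by (simp add: twisted_space_def)
  have E: "E A + E B * y = (\<Sum>i=0..m + 2. \<iota> (coeff A i) * x ^ i) +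
      (\<Sum>j=0..m. \<iota> (coeff B j) * x ^ j * y) + \<iota> (coeff A (m + 2)) * \<iota> \<eta> * x ^ (m + 1) * y"
    if "(A, B) \<in> twisted_pairs (m + 2) (m + 1) (inverse \<eta>)" for A B
  proof -
    have "degree A \<le> m + 2" "degree B \<le> Suc m" "coeff B (Suc m) = \<eta> * coeff A (m + 2)"
      using that assms by (auto simp: twisted_pairs_def)
    then show ?thesis
      by (simp add: E_eq_sum[of A "m + 2"] E_eq_sum[of B "Suc m"] sum_distrib_right hom_distribs
          algebra_simps)
  qed
  show ?thesis
  proof (intro equalityI subsetI)
    fix g assume "g \<in> ?L"
    then obtain a b where g: "g = (\<Sum>i=0..m + 2. \<iota> (a i) * x ^ i) +
        (\<Sum>j=0..m. \<iota> (b j) * x ^ j * y) + \<iota> (a (m + 2)) * \<iota> \<eta> * x ^ (m + 1) * y"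
      unfolding L by blast
    obtain A where A: "degree A \<le> m + 2" "\<And>i. i \<le> m + 2 \<Longrightarrow> coeff A i = a i"
      using obtain_poly_with_coeffs[of "m + 2" a] by blast
    obtain B where B: "degree B \<le> m + 1"
        "\<And>j. j \<le> m + 1 \<Longrightarrow> coeff B j = (if j = m + 1 then \<eta> * a (m + 2) else b j)"
      using obtain_poly_with_coeffs[of "m + 1" "\<lambda>j. if j = m + 1 then \<eta> * a (m + 2) else b j"] by blast
    have AB: "(A, B) \<in> twisted_pairs (m + 2) (m + 1) (inverse \<eta>)"
      using A B assms by (simp add: twisted_pairs_def)
    have "g = E A + E B * y"
      unfolding E[OF AB] g by (auto simp: A B intro!: arg_cong2[of _ _ _ _ "(+)"] sum.cong)
    with AB show "g \<in> ?R" by force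
  next
    fix g assume "g \<in> ?R"
    then obtain A B where AB: "(A, B) \<in> twisted_pairs (m + 2) (m + 1) (inverse \<eta>)" and g: "g = E A + E B * y"
      by auto
    show "g \<in> ?L"
      unfolding L mem_Collect_eq g E[OF AB] by (intro exI[of _ "coeff A"] exI[of _ "coeff B"]) simp
  qed
qed

end

theorem mainTheorem9:
  fixes \<iota> :: "'K::{field,finite} \<Rightarrow> 'F::field"
    and f :: "'K poly" and x y t :: 'F
    and T :: "'K set" and k n l :: nat
    and P :: "nat \<Rightarrow> 'K \<times> 'K" and \<gamma> v :: "nat \<Rightarrow> 'K" and \<eta> :: 'K
  assumes "even (card (UNIV :: 'K set))"
    and "second_type_function_field \<iota> f x y"
    and "k \<ge> 3" and "n = 2 * k"
    and "card T = k" and "\<forall>\<alpha>\<in>T. \<exists>\<beta>. \<beta>\<^sup>2 + \<beta> = poly f \<alpha>"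
    and "bij_betw P {0..<n} (affine_points f T)"
    and "t = (\<Prod>\<alpha>\<in>T. x - \<iota> \<alpha>)"
    and "\<forall>i<n. \<gamma> i = residue_at \<iota> x y (1 / t) x (P i)"
    and "l = (if odd k then (k - 3) div 2 else k div 2)"
    and "\<eta> \<noteq> 0" and "\<forall>i<n. v i \<noteq> 0"
  shows "(odd k \<longrightarrow>
            (self_dual n (tgec_code \<iota> x y n P k l \<eta> v) \<longleftrightarrow>
              (\<Sum>i<n. \<gamma> i * fst (P i) ^ (k + 1)) = 0 \<and>
              (\<exists>c. c \<noteq> 0 \<and> (\<forall>i<n. (v i)\<^sup>2 = c * \<gamma> i)))) \<and>
         (even k \<longrightarrow>
            (self_dual n (tgec_code \<iota> x y n P k l \<eta> v) \<longleftrightarrow>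
              (\<Sum>i<n. \<gamma> i * fst (P i) ^ (k - 2) * (snd (P i))\<^sup>2) = 0 \<and>
              (\<exists>\<mu>. \<mu> \<noteq> 0 \<and> (\<forall>i<n. (v i)\<^sup>2 = \<mu> * \<gamma> i))))"
proof -
  have two: "(2::'K) = 0"
    using assms(1) by (rule even_card_imp_char_2)
  interpret second_type \<iota> f x y by unfold_locales fact
  define b where "b a = (SOME \<beta>. \<beta>\<^sup>2 + \<beta> = poly f a)" for a
  have T: "finite T" "T \<noteq> {}" using assms(3,5) by auto
  interpret evaluation_points f T b
  proof
    show "(b a)\<^sup>2 + b a = poly f a" if "a \<in> T" for a
      unfolding b_def using someI_ex[of "\<lambda>\<beta>. \<beta>\<^sup>2 + \<beta> = poly f a"] assms(6) that by blast
  qed (fact two T)+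
  have mem: "P i \<in> affine_points f T" if "i < n" for i
    using assms(7) that by (auto dest: bij_betwE)
  have \<gamma>: "\<gamma> i = node_weight T (fst (P i))" if "i < n" for i
  proof -
    obtain a c where P: "P i = (a, c)" by fastforce
    with mem[OF that] have "c\<^sup>2 + c = poly f a" "a \<in> T" by (auto simp: affine_points_def)
    then show ?thesis
      using assms(9) that residue_at_simple_pole[OF two _ T(1)]
      by (simp add: P assms(8) node_weight_def)
  qed
  have sum_points: "(\<Sum>i<n. G (P i)) = (\<Sum>a\<in>T. G (a, b a) + G (a, b a + 1))" for G :: "_ \<Rightarrow> 'K"
    unfolding lessThan_atLeast0 sum.reindex_bij_betw[OF assms(7)] sum_affine_points ..
  have code: "tgec_code \<iota> x y n P k l \<eta> v = twisted_code n P r s \<theta> v"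
    if "twisted_space \<iota> x y k l \<eta> = (\<lambda>(A, B). E A + E B * y) ` twisted_pairs r s \<theta>" for r s \<theta>
  proof -
    have val: "value_at \<iota> x y (E A + E B * y) (P i) = pvalue (A, B) (P i)" if "i < n" for A B i
    proof -
      obtain a c where P: "P i = (a, c)" by fastforce
      with mem[OF that] have "c\<^sup>2 + c = poly f a" by (auto simp: affine_points_def)
      then show ?thesis using value_at_affine[OF two] by (simp add: P pvalue_def)
    qed
    have vec: "vec n (\<lambda>i. v i * value_at \<iota> x y (E A + E B * y) (P i)) =
        vec n (\<lambda>i. v i * pvalue (A, B) (P i))" for A B
      by (rule eq_vecI) (simp_all add: val)
    have "tgec_code \<iota> x y n P k l \<eta> v =
        (\<lambda>(A, B). vec n (\<lambda>i. v i * value_at \<iota> x y (E A + E B * y) (P i))) ` twisted_pairs r s \<theta>"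
      unfolding tgec_code_def that by (force simp: image_iff)
    then show ?thesis
      by (simp only: vec twisted_code_def case_prod_eta[of "\<lambda>g. vec n (\<lambda>i. v i * pvalue g (P i))"])
  qed
  \<comment> \<open>The criterion for the proportionality condition alone; each parity below
    supplies r, s and \<theta> and the vanishing of its sum.\<close>
  have dual: "self_dual n (tgec_code \<iota> x y n P k l \<eta> v) \<longleftrightarrow>
      (\<exists>c. c \<noteq> 0 \<and> (\<forall>i<n. (v i)\<^sup>2 = c * \<gamma> i))"
    if "twisted_space \<iota> x y k l \<eta> = (\<lambda>(A, B). E A + E B * y) ` twisted_pairs r s \<theta>"
      "k = r + s + 1" "r = s + 1 \<or> r = s + 2" for r s \<theta>
    unfolding code[OF that(1)]
    using self_dual_twisted_code_iff[of r s P n v \<theta>] that(2,3) assms(3,5,7,12) degree_f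
    by (simp add: \<gamma>)
  show ?thesis
  proof (intro conjI impI)
    assume "odd k"
    then obtain m where m: "k = 2 * m + 3"
      using assms(3) by (metis add.commute le_add_diff_inverse even_add odd_numeral evenE)
    have l: "l = m" using assms(10) m by simp
    have "(\<Sum>i<n. \<gamma> i * fst (P i) ^ (k + 1)) =
        (\<Sum>i<n. node_weight T (fst (P i)) * fst (P i) ^ (k + 1))"
      by (simp add: \<gamma>)
    also have "\<dots> = 0"
      by (subst sum_points[of "\<lambda>p. node_weight T (fst p) * fst p ^ (k + 1)"]) simp
    finally have "(\<Sum>i<n. \<gamma> i * fst (P i) ^ (k + 1)) = 0" .
    then show "self_dual n (tgec_code \<iota> x y n P k l \<eta> v) \<longleftrightarrow>
        (\<Sum>i<n. \<gamma> i * fst (P i) ^ (k + 1)) = 0 \<and>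
        (\<exists>c. c \<noteq> 0 \<and> (\<forall>i<n. (v i)\<^sup>2 = c * \<gamma> i))"
      using dual[of "m + 2" m \<eta>] twisted_space_odd[of m \<eta>] by (simp add: m l)
  next
    assume "even k"
    then obtain m where m: "k = 2 * m + 4"
    proof -
      from \<open>even k\<close> obtain j where "k = 2 * j" by blast
      then have "k = 2 * (j - 2) + 4" using assms(3) by simp
      then show thesis by (rule that)
    qed
    have l: "l = m + 2" using assms(10) m by simp
    have sq: "c\<^sup>2 + (c + 1)\<^sup>2 = 1" for c :: 'K
      by (simp add: power2_eq_square algebra_simps)
    have "(\<Sum>i<n. \<gamma> i * fst (P i) ^ (k - 2) * (snd (P i))\<^sup>2) =
        (\<Sum>i<n. node_weight T (fst (P i)) * fst (P i) ^ (k - 2) * (snd (P i))\<^sup>2)"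
      by (simp add: \<gamma>)
    also have "\<dots> = (\<Sum>a\<in>T. node_weight T a * poly (monom 1 (k - 2)) a)"
      by (subst sum_points[of "\<lambda>p. node_weight T (fst p) * fst p ^ (k - 2) * (snd p)\<^sup>2"])
        (simp add: sq poly_monom flip: distrib_left)
    \<comment> \<open>The exponent k - 2 is one below \<open>card T - 1\<close>, where the
      coefficient is read off.\<close>
    also have "\<dots> = 0"
      using assms(3,5) by (subst sum_node_weight_poly[OF T]) (simp_all add: degree_monom_eq)
    finally have "(\<Sum>i<n. \<gamma> i * fst (P i) ^ (k - 2) * (snd (P i))\<^sup>2) = 0" .
    then show "self_dual n (tgec_code \<iota> x y n P k l \<eta> v) \<longleftrightarrow>
        (\<Sum>i<n. \<gamma> i * fst (P i) ^ (k - 2) * (snd (P i))\<^sup>2) = 0 \<and>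
        (\<exists>\<mu>. \<mu> \<noteq> 0 \<and> (\<forall>i<n. (v i)\<^sup>2 = \<mu> * \<gamma> i))"
      using dual[of "m + 2" "m + 1" "inverse \<eta>"] twisted_space_even[of \<eta> m] assms(11)
      by (simp add: m l)
  qed
qed

end
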